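(* Let $X$ be a finite set, let $G$ be a subgroup of $\mathrm{Aut}(X)$ that acts transitively on $X$, and let $F$ be a map from $\mathbb{R}^X$ to $\mathbb{R}^X$. Then $F$ is a linear group equivariant non-expansive operator for $(\mathbb{R}^X,G)$ if and only if there exists a permutant measure $\mu$ with respect to $G$ such that $$F(\varphi)=\sum_{h\in \mathrm{Aut}(X)}\varphi h^{-1}\,\mu(h)\quad\text{for every }\varphi\in\mathbb{R}^X,$$ and $\sum_{h\in\mathrm{Aut}(X)}|\mu(h)|\le 1$.
   Context: $X$ is a finite (nonempty) set and $\mathbb{R}^X$ is the vector space of all functions $X\to\mathbb{R}$, with norm $\|\varphi\|_\infty=\max_{x\in X}|\varphi(x)|$. $\mathrm{Aut}(X)$ is the group of all permutations of $X$; it acts on $\mathbb{R}^X$ by composition on the right, and juxtaposition denotes composition of functions: $\varphi g=\varphi\circ g$, $h_1h_2=h_1\circ h_2$. For a subgroup $G\subseteq\mathrm{Aut}(X)$, a group equivariant operator (GEO) for $(\mathbb{R}^X,G)$ is a function $F:\mathbb{R}^X\to\mathbb{R}^X$ such that $F(\varphi g)=F(\varphi)g$ for all $\varphi\in\mathbb{R}^X$ and $g\in G$. A group equivariant non-expansive operator (GENEO) is a GEO $F$ such that $\|F(\varphi_1)-F(\varphi_2)\|_\infty\le\|\varphi_1-\varphi_2\|_\infty$ for all $\varphi_1,\varphi_2\in\mathbb{R}^X$. A permutant measure with respect to $G$ is a finite signed measure $\mu$ on $\mathrm{Aut}(X)$ for which every subset of $\mathrm{Aut}(X)$ is measurable and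 $\mu(H)=\mu(gHg^{-1})$ for every $H\subseteq\mathrm{Aut}(X)$ and every $g\in G$ (equivalently, $\mu(\{h\})=\mu(\{ghg^{-1}\})$ for all $h\in\mathrm{Aut}(X)$, $g\in G$). One writes $\mu(h)$ for $\mu(\{h\})$. *)

theory Defs
  imports "HOL-Analysis.Analysis" "HOL-Algebra.Group_Action"
begin

text \<open>
  The finite nonempty set \<open>X\<close> is the universe of a type \<open>'a\<close> of class \<open>finite\<close>, and the space of all
  functions from \<open>X\<close> to the reals is \<open>real ^ 'a\<close>.  This gives access to the library notions
  \<open>linear\<close> and \<open>infnorm\<close>; note that \<open>norm\<close> on this type is the Euclidean norm.
\<close>

abbreviation Aut :: "('a::finite \<Rightarrow> 'a) monoid" where
  "Aut \<equiv> BijGroup UNIV"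

lemma mem_carrier_Aut: "h \<in> carrier Aut \<longleftrightarrow> bij h"
  by (auto simp: BijGroup_def Bij_def extensional_def)

lemma mult_Aut:
  assumes "bij g" "bij h"
  shows "g \<otimes>\<^bsub>Aut\<^esub> h = g \<circ> h"
  using assms by (auto simp: BijGroup_def Bij_def extensional_def compose_def fun_eq_iff)

lemma infnorm_eq_Max:
  fixes \<phi> :: "real ^ 'a::finite"
  shows "infnorm \<phi> = Max (range (\<lambda>x. \<bar>\<phi> $ x\<bar>))"
proof -
  have "{\<bar>\<phi> $ x\<bar> | x. x \<in> UNIV} = range (\<lambda>x. \<bar>\<phi> $ x\<bar>)"
    by auto
  then show ?thesis
    by (simp add: infnorm_cart cSup_eq_Max)
qed

definition comp_right :: "real ^ 'a \<Rightarrow> ('a \<Rightarrow> 'a) \<Rightarrow> real ^ 'a" where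
  "comp_right \<phi> g = (\<chi> x. \<phi> $ g x)"

definition acts_transitively :: "('a::finite \<Rightarrow> 'a) set \<Rightarrow> bool" where
  "acts_transitively G \<longleftrightarrow> transitive_action (Aut\<lparr>carrier := G\<rparr>) UNIV (\<lambda>g. g)"

lemma acts_transitively_iff:
  assumes "subgroup G Aut"
  shows "acts_transitively G \<longleftrightarrow> (\<forall>x y. \<exists>g\<in>G. g x = y)"
proof -
  have "group (Aut\<lparr>carrier := G\<rparr>)"
    using assms group.subgroup_imp_group group_BijGroup by blast
  moreover have "(\<lambda>g. g) \<in> hom (Aut\<lparr>carrier := G\<rparr>) Aut"
    using subgroup.subset[OF assms] by (auto simp: hom_def)
  ultimately have "group_action (Aut\<lparr>carrier := G\<rparr>) UNIV (\<lambda>g. g)"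
    by (simp add: group_action_def group_hom_def group_hom_axioms_def group_BijGroup)
  then show ?thesis
    by (simp add: acts_transitively_def transitive_action_def transitive_action_axioms_def)
qed

definition GEO :: "('a \<Rightarrow> 'a) set \<Rightarrow> (real ^ 'a \<Rightarrow> real ^ 'a) \<Rightarrow> bool" where
  "GEO G F \<longleftrightarrow> (\<forall>\<phi>. \<forall>g\<in>G. F (comp_right \<phi> g) = comp_right (F \<phi>) g)"

definition GENEO :: "('a::finite \<Rightarrow> 'a) set \<Rightarrow> (real ^ 'a \<Rightarrow> real ^ 'a) \<Rightarrow> bool" where
  "GENEO G F \<longleftrightarrow> GEO G F \<and> (\<forall>\<phi>\<^sub>1 \<phi>\<^sub>2. infnorm (F \<phi>\<^sub>1 - F \<phi>\<^sub>2) \<le> infnorm (\<phi>\<^sub>1 - \<phi>\<^sub>2))"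

definition finite_signed_measure :: "'b set \<Rightarrow> 'b set set \<Rightarrow> ('b set \<Rightarrow> real) \<Rightarrow> bool" where
  "finite_signed_measure \<Omega> M \<mu> \<longleftrightarrow>
     sigma_algebra \<Omega> M \<and> \<mu> {} = 0 \<and>
     (\<forall>A :: nat \<Rightarrow> 'b set. range A \<subseteq> M \<longrightarrow> disjoint_family A \<longrightarrow>
        (\<lambda>i. \<mu> (A i)) sums \<mu> (\<Union>i. A i))"

text \<open>
  Algebra's notation for group inverses makes \<open>inv\<close> unavailable as a function symbol, so the
  inverse of a permutation \<open>g\<close> is written \<open>inv_into UNIV g\<close>.
\<close>

definition permutant_measure ::
    "('a::finite \<Rightarrow> 'a) set \<Rightarrow> (('a \<Rightarrow> 'a) set \<Rightarrow> real) \<Rightarrow> bool" where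
  "permutant_measure G \<mu> \<longleftrightarrow>
     finite_signed_measure (carrier Aut) (Pow (carrier Aut)) \<mu> \<and>
     (\<forall>H. H \<subseteq> carrier Aut \<longrightarrow>
        (\<forall>g\<in>G. \<mu> H = \<mu> ((\<lambda>h. g \<circ> h \<circ> inv_into UNIV g) ` H)))"

end

theory Submission
  imports Defs
begin

text \<open>
  A linear map \<open>F\<close> is given by a matrix \<open>B\<close>, and \<open>F\<close> is equivariant and non-expansive exactly
  when \<open>B (g y) (g x) = B y x\<close> for all \<open>g \<in> G\<close> and every row of \<open>B\<close> has absolute sum at most 1.
  A measure \<open>\<mu>\<close> represents \<open>F\<close> exactly when \<open>B\<close> is the sum of the permutation matrices of the
  \<open>h\<close>, weighted by \<open>\<mu> {h}\<close>, where the matrix of \<open>h\<close> has its ones at the entries \<open>(h x, x)\<close>.  From such a measure one reads off both properties at once: conjugation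
  invariance of \<open>\<mu>\<close> gives equivariance, and the total variation of \<open>\<mu>\<close> bounds the row sums.

  Conversely, the positive and the negative part of \<open>B\<close> are again invariant under \<open>G\<close>.
  Transitivity forces each of them to have the same sum in every row and in every column
  (\<open>transitive_invariant_sums\<close>), so each is a nonnegative multiple of a doubly stochastic matrix
  and, by Birkhoff's theorem (\<open>birkhoff\<close>, proved from Hall's theorem), a nonnegative combination of
  permutation matrices whose weights add up to that common sum.  The difference of the two weight
  functions represents \<open>B\<close>, and its absolute sum is at most the absolute row sum of \<open>B\<close>, because
  the positive and the negative part split that row sum without cancellation.  The weights
  need not be invariant, but their average over conjugation by \<open>G\<close> is.  It still represents \<open>B\<close>, as
  \<open>B\<close> itself is invariant, and averaging does not increase the absolute sum.
\<close>

section \<open>Hall's and Birkhoff's theorems\<close>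

text \<open>
  The Halmos--Vaughan argument.  If every proper nonempty subfamily has a spare element, any
  choice for one index can be removed and Hall's condition survives.  Otherwise some proper
  subfamily \<open>J\<close> is tight; it is matched within its own union, and the remaining sets still
  satisfy Hall's condition outside that union, because \<open>J\<close> together with any further
  indices does.
\<close>

lemma hall:
  fixes S :: "'i \<Rightarrow> 'b set"
  assumes "finite I" and "\<And>i. i \<in> I \<Longrightarrow> finite (S i)"
    and "\<And>J. J \<subseteq> I \<Longrightarrow> card J \<le> card (\<Union>(S ` J))"
  shows "\<exists>f. inj_on f I \<and> (\<forall>i\<in>I. f i \<in> S i)"
  using assms
proof (induction "card I" arbitrary: I S rule: less_induct)
  case less
  note finI = less.prems(1) and finS = less.prems(2) and hc = less.prems(3)
  have finU: "finite (\<Union>(S ` J))" if "J \<subseteq> I" for J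
    using that finI finS by (meson finite_UN_I finite_subset subsetD)
  consider "I = {}"
    | i where "i \<in> I" "\<And>J. J \<subset> I \<Longrightarrow> J \<noteq> {} \<Longrightarrow> card J < card (\<Union>(S ` J))"
    | J where "J \<subset> I" "J \<noteq> {}" "card (\<Union>(S ` J)) \<le> card J"
    by (metis all_not_in_conv leI)
  then show ?case
  proof cases
    case 1
    then show ?thesis by auto
  next
    case 2
    have "card {i} \<le> card (S i)"
      using hc[of "{i}"] 2(1) by simp
    then obtain x where x: "x \<in> S i"
      by fastforce
    let ?I = "I - {i}" and ?S = "\<lambda>j. S j - {x}"
    have "\<exists>f. inj_on f ?I \<and> (\<forall>j\<in>?I. f j \<in> ?S j)"
    proof (rule less.hyps)
      show "card ?I < card I"
        using finI 2(1) by (meson card_Diff1_less)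
      show "card J \<le> card (\<Union>(?S ` J))" if J: "J \<subseteq> ?I" for J
      proof (cases "J = {}")
        case False
        have "card J < card (\<Union>(S ` J))"
          using 2 J False by blast
        moreover have "\<Union>(?S ` J) = \<Union>(S ` J) - {x}"
          by auto
        ultimately show ?thesis
          by (auto simp add: card_Diff_singleton_if)
      qed simp
    qed (use finI finS in auto)
    then obtain f where f: "inj_on f ?I" "\<And>j. j \<in> ?I \<Longrightarrow> f j \<in> ?S j"
      by blast
    have "inj_on (f(i := x)) I"
      using f by (auto simp: inj_on_def)
    moreover have "\<forall>j\<in>I. (f(i := x)) j \<in> S j"
      using f x by auto
    ultimately show ?thesis
      by blast
  next
    case 3
    let ?T = "\<Union>(S ` J)" and ?S = "\<lambda>i. S i - \<Union>(S ` J)"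
    have finJ: "finite J"
      using 3(1) finI finite_subset by blast
    have "\<exists>f. inj_on f J \<and> (\<forall>i\<in>J. f i \<in> S i)"
      using 3 finI finS hc finJ by (intro less.hyps psubset_card_mono) auto
    then obtain f where f: "inj_on f J" "\<And>i. i \<in> J \<Longrightarrow> f i \<in> S i"
      by blast
    have "\<exists>g. inj_on g (I - J) \<and> (\<forall>i\<in>I - J. g i \<in> ?S i)"
    proof (rule less.hyps)
      show "card (I - J) < card I"
        using 3 finI by (intro psubset_card_mono) auto
      show "card K \<le> card (\<Union>(?S ` K))" if K: "K \<subseteq> I - J" for K
      proof -
        have "card J + card K = card (J \<union> K)"
          using K finI finJ by (intro card_Un_disjoint [symmetric]) (auto intro: finite_subset)
        also have "\<dots> \<le> card (\<Union>(S ` (J \<union> K)))"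
          using 3(1) K by (intro hc) auto
        also have "\<Union>(S ` (J \<union> K)) = ?T \<union> \<Union>(?S ` K)"
          by auto
        also have "card \<dots> \<le> card ?T + card (\<Union>(?S ` K))"
          by (rule card_Un_le)
        finally show ?thesis
          using 3(3) by linarith
      qed
    qed (use finI finS in auto)
    then obtain g where g: "inj_on g (I - J)" "\<And>i. i \<in> I - J \<Longrightarrow> g i \<in> ?S i"
      by blast
    let ?h = "\<lambda>i. if i \<in> J then f i else g i"
    have ne: "f i \<noteq> g j" if "i \<in> J" "j \<in> I - J" for i j
      using f(2)[OF that(1)] g(2)[OF that(2)] that(1) by auto
    have "inj_on ?h I"
    proof (rule inj_onI)
      fix i j assume "i \<in> I" "j \<in> I" "?h i = ?h j"
      then show "i = j"
        using inj_onD[OF f(1), of i j] inj_onD[OF g(1), of i j] ne[of i j] ne[of j i]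
        by (auto split: if_splits)
    qed
    moreover have "\<forall>i\<in>I. ?h i \<in> S i"
      using f g by auto
    ultimately show ?thesis
      by blast
  qed
qed

text \<open>
  Hall's condition for the positive entries comes from weighing: the columns in \<open>J\<close> carry total
  mass \<open>s * card J\<close>, all of it in rows that meet \<open>J\<close> positively, and \<open>k\<close> rows
  cannot carry more than \<open>s * k\<close>.
\<close>

lemma positive_diagonal:
  fixes B :: "'a::finite \<Rightarrow> 'a \<Rightarrow> real"
  assumes nonneg: "\<And>y x. 0 \<le> B y x"
    and row: "\<And>y. (\<Sum>x\<in>UNIV. B y x) = s" and col: "\<And>x. (\<Sum>y\<in>UNIV. B y x) = s"
    and "0 < s"
  obtains h where "bij h" "\<And>x. 0 < B (h x) x"
proof -
  let ?S = "\<lambda>x. {y. 0 < B y x}"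
  have hc: "card J \<le> card (\<Union>(?S ` J))" for J
  proof -
    let ?U = "\<Union>(?S ` J)"
    have "s * card J = (\<Sum>x\<in>J. \<Sum>y\<in>UNIV. B y x)"
      by (simp add: col)
    also have "\<dots> = (\<Sum>x\<in>J. \<Sum>y\<in>?U. B y x)"
    proof (rule sum.cong[OF refl], rule sum.mono_neutral_right)
      fix x assume "x \<in> J"
      then show "\<forall>y\<in>UNIV - ?U. B y x = 0"
        using nonneg by (auto simp: not_less intro: antisym)
    qed auto
    also have "\<dots> = (\<Sum>y\<in>?U. \<Sum>x\<in>J. B y x)"
      by (rule sum.swap)
    also have "\<dots> \<le> (\<Sum>y\<in>?U. \<Sum>x\<in>UNIV. B y x)"
      by (intro sum_mono sum_mono2) (auto simp: nonneg)
    also have "\<dots> = s * card ?U"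
      by (simp add: row)
    finally show ?thesis
      using \<open>0 < s\<close> by simp
  qed
  have "\<exists>h. inj_on h UNIV \<and> (\<forall>x\<in>UNIV. h x \<in> ?S x)"
    by (rule hall) (auto intro: hc)
  then obtain h where "inj h" "\<And>x. 0 < B (h x) x"
    by auto
  then show thesis
    by (intro that) (auto simp: bij_def finite_UNIV_inj_surj)
qed

text \<open>
  Subtracting the largest admissible multiple of a permutation matrix found on the positive entries
  keeps the row and column sums equal and kills at least one entry, so the induction is on
  the number of nonzero entries.
\<close>

lemma birkhoff:
  fixes B :: "'a::finite \<Rightarrow> 'a \<Rightarrow> real"
  assumes "\<And>y x. 0 \<le> B y x"
    and "\<And>y. (\<Sum>x\<in>UNIV. B y x) = s" and "\<And>x. (\<Sum>y\<in>UNIV. B y x) = s"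
  shows "\<exists>c. (\<forall>h. 0 \<le> c h) \<and> (\<forall>y x. B y x = (\<Sum>h | bij h. c h * of_bool (h x = y))) \<and>
    (\<Sum>h | bij h. c h) = s"
  using assms
proof (induction "card {(y, x). B y x \<noteq> 0}" arbitrary: B s rule: less_induct)
  case less
  note nonneg = less.prems(1) and row = less.prems(2) and col = less.prems(3)
  have "0 \<le> s"
    using row[of undefined] nonneg by (metis sum_nonneg)
  then consider "s = 0" | "0 < s"
    by linarith
  then show ?case
  proof cases
    case 1
    have "B y x = 0" for y x
      using row[of y] 1 nonneg by (simp add: sum_nonneg_eq_0_iff)
    then show ?thesis
      using 1 by (intro exI[of _ "\<lambda>_. 0"]) simp
  next
    case 2
    obtain h where h: "bij h" "\<And>x. 0 < B (h x) x"
      using positive_diagonal[OF nonneg row col 2] by blast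
    define t where "t = Min (range (\<lambda>x. B (h x) x))"
    have "t \<in> range (\<lambda>x. B (h x) x)"
      unfolding t_def by (intro Min_in) auto
    then obtain x0 where x0: "t = B (h x0) x0"
      by auto
    have t_le: "t \<le> B (h x) x" for x
      unfolding t_def by (intro Min_le) auto
    define B' where "B' = (\<lambda>y x. B y x - t * of_bool (h x = y))"
    \<comment> \<open>This form lets the simplifier evaluate row sums, which range over \<open>x\<close>.\<close>
    have hx: "h x = y \<longleftrightarrow> x = inv_into UNIV h y" for x y
      using h(1) by (metis bij_inv_eq_iff)
    have row_h: "(\<Sum>x\<in>UNIV. t * of_bool (h x = y)) = t" for y
      by (simp add: hx of_bool_def flip: sum_distrib_left)
    have col_h: "(\<Sum>y\<in>UNIV. t * of_bool (h x = y)) = t" for x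
      by (simp add: of_bool_def flip: sum_distrib_left)
    have "\<exists>c. (\<forall>k. 0 \<le> c k) \<and> (\<forall>y x. B' y x = (\<Sum>k | bij k. c k * of_bool (k x = y))) \<and>
        (\<Sum>k | bij k. c k) = s - t"
    proof (rule less.hyps)
      have "{(y, x). B' y x \<noteq> 0} \<subseteq> {(y, x). B y x \<noteq> 0}"
      proof clarsimp
        fix y x assume "B' y x \<noteq> 0" "B y x = 0"
        then show False
          using h(2)[of x] by (cases "h x = y") (simp_all add: B'_def)
      qed
      moreover have "B' (h x0) x0 = 0" "B (h x0) x0 \<noteq> 0"
        using h(2)[of x0] by (auto simp: B'_def x0)
      ultimately have "{(y, x). B' y x \<noteq> 0} \<subset> {(y, x). B y x \<noteq> 0}"
        by blast
      then show "card {(y, x). B' y x \<noteq> 0} < card {(y, x). B y x \<noteq> 0}"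
        by (intro psubset_card_mono) simp_all
      show "0 \<le> B' y x" for y x
        using nonneg[of y x] t_le[of x] by (auto simp: B'_def)
      show "(\<Sum>x\<in>UNIV. B' y x) = s - t" for y
        by (simp only: B'_def sum_subtractf row row_h)
      show "(\<Sum>y\<in>UNIV. B' y x) = s - t" for x
        by (simp only: B'_def sum_subtractf col col_h)
    qed
    then obtain c where c: "\<And>k. 0 \<le> c k"
        "\<And>y x. B' y x = (\<Sum>k | bij k. c k * of_bool (k x = y))" "(\<Sum>k | bij k. c k) = s - t"
      by blast
    let ?c = "\<lambda>k. c k + t * of_bool (k = h)"
    have c_nonneg: "0 \<le> ?c k" for k
      using c(1) h(2) x0 by (simp add: less_imp_le)
    have c_eq: "B y x = (\<Sum>k | bij k. ?c k * of_bool (k x = y))" for y x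
    proof -
      have "(\<Sum>k | bij k. t * of_bool (k = h) * of_bool (k x = y)) =
          (\<Sum>k | bij k. if k = h then t * of_bool (h x = y) else 0)"
        by (intro sum.cong) auto
      also have "\<dots> = t * of_bool (h x = y)"
        using h(1) by simp
      finally show ?thesis
        using c(2)[of y x] by (simp add: B'_def distrib_right sum.distrib del: sum_mult_of_bool_eq)
    qed
    have c_sum: "(\<Sum>k | bij k. ?c k) = s"
      using c(3) h(1) by (simp add: sum.distrib of_bool_def flip: sum_distrib_left)
    show ?thesis
      by (intro exI[of _ ?c] conjI allI c_nonneg c_eq c_sum)
  qed
qed

section \<open>Permutation groups and invariant matrices\<close>

lemma subgroup_Aut_facts:
  fixes G :: "('a::finite \<Rightarrow> 'a) set"
  assumes "subgroup G Aut"
  shows "\<And>g. g \<in> G \<Longrightarrow> bij g"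
    and "\<And>g k. g \<in> G \<Longrightarrow> k \<in> G \<Longrightarrow> g \<circ> k \<in> G"
    and "\<And>g. g \<in> G \<Longrightarrow> inv_into UNIV g \<in> G"
    and "id \<in> G"
proof -
  interpret subgroup G Aut by fact
  show bij: "bij g" if "g \<in> G" for g
    using that subset mem_carrier_Aut by blast
  show "g \<circ> k \<in> G" if "g \<in> G" "k \<in> G" for g k
    using m_closed[OF that] bij that by (simp add: mult_Aut)
  show "inv_into UNIV g \<in> G" if "g \<in> G" for g
    using m_inv_closed[OF that] bij[OF that]
    by (simp add: inv_BijGroup Bij_def extensional_def restrict_def)
  show "id \<in> G"
    using one_closed by (simp add: BijGroup_def id_def restrict_def)
qed

text \<open>
  Relabelling by \<open>g\<close> turns the row \<open>y\<close> into the row \<open>g y\<close>, so by transitivity all row sums agree, and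
  likewise all column sums.  The two common values agree because both equal the sum of all
  entries divided by the size of the set.
\<close>

lemma transitive_invariant_sums:
  fixes K :: "'a::finite \<Rightarrow> 'a \<Rightarrow> real"
  assumes bij: "\<And>g. g \<in> G \<Longrightarrow> bij g" and trans: "\<And>x y. \<exists>g\<in>G. g x = y"
    and inv: "\<And>g y x. g \<in> G \<Longrightarrow> K (g y) (g x) = K y x"
  obtains s where "\<And>y. (\<Sum>x\<in>UNIV. K y x) = s" "\<And>x. (\<Sum>y\<in>UNIV. K y x) = s"
proof -
  have row: "(\<Sum>x\<in>UNIV. K y x) = (\<Sum>x\<in>UNIV. K y' x)" for y y'
  proof -
    obtain g where g: "g \<in> G" "g y = y'"
      using trans by blast
    have "(\<Sum>x\<in>UNIV. K y' x) = (\<Sum>x\<in>UNIV. K (g y) (g x))"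
      using sum.reindex_bij_betw[OF bij[OF g(1)], of "K y'"] g(2) by simp
    then show ?thesis
      using inv[OF g(1)] by simp
  qed
  have col: "(\<Sum>y\<in>UNIV. K y x) = (\<Sum>y\<in>UNIV. K y x')" for x x'
  proof -
    obtain g where g: "g \<in> G" "g x = x'"
      using trans by blast
    have "(\<Sum>y\<in>UNIV. K y x') = (\<Sum>y\<in>UNIV. K (g y) (g x))"
      using sum.reindex_bij_betw[OF bij[OF g(1)], of "\<lambda>y. K y x'"] g(2) by simp
    then show ?thesis
      using inv[OF g(1)] by simp
  qed
  define r where "r = (\<Sum>x\<in>UNIV. K undefined x)"
  define c where "c = (\<Sum>y\<in>UNIV. K y undefined)"
  have r: "(\<Sum>x\<in>UNIV. K y x) = r" for y
    unfolding r_def by (rule row)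
  have c: "(\<Sum>y\<in>UNIV. K y x) = c" for x
    unfolding c_def by (rule col)
  have "r * CARD('a) = (\<Sum>y\<in>UNIV. \<Sum>x\<in>UNIV. K y x)"
    by (simp add: r)
  also have "\<dots> = (\<Sum>x\<in>UNIV. \<Sum>y\<in>UNIV. K y x)"
    by (rule sum.swap)
  also have "\<dots> = c * CARD('a)"
    by (simp add: c)
  finally have "r = c"
    by simp
  then show thesis
    using that r c by blast
qed

text \<open>
  The positive and the negative part of \<open>B\<close> are decomposed separately by \<open>birkhoff\<close>.  Their
  weights add up to their row sums, and these add up to the row sum of \<open>\<bar>B\<bar>\<close>, because no
  entry is nonzero in both parts.
\<close>

lemma signed_birkhoff:
  fixes B :: "'a::finite \<Rightarrow> 'a \<Rightarrow> real"
  assumes bij: "\<And>g. g \<in> G \<Longrightarrow> bij g" and trans: "\<And>x y. \<exists>g\<in>G. g x = y"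
    and inv: "\<And>g y x. g \<in> G \<Longrightarrow> B (g y) (g x) = B y x"
  obtains a where "\<And>y x. B y x = (\<Sum>h | bij h. a h * of_bool (h x = y))"
    and "\<And>y. (\<Sum>h | bij h. \<bar>a h\<bar>) \<le> (\<Sum>x\<in>UNIV. \<bar>B y x\<bar>)"
proof -
  have decompose: "\<exists>s c. (\<forall>h. 0 \<le> c h) \<and>
      (\<forall>y x. K y x = (\<Sum>h | bij h. c h * of_bool (h x = y))) \<and>
      (\<Sum>h | bij h. c h) = s \<and> (\<forall>y. (\<Sum>x\<in>UNIV. K y x) = s)"
    if nonneg: "\<And>y x. 0 \<le> K y x"
      and invK: "\<And>g y x. g \<in> G \<Longrightarrow> K (g y) (g x) = K y x"
    for K :: "'a \<Rightarrow> 'a \<Rightarrow> real"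
  proof -
    obtain s where s: "\<And>y. (\<Sum>x\<in>UNIV. K y x) = s" "\<And>x. (\<Sum>y\<in>UNIV. K y x) = s"
      using transitive_invariant_sums[of G K] bij trans invK by blast
    show ?thesis
      using birkhoff[OF nonneg s] s(1) by blast
  qed
  define P where "P = (\<lambda>y x. max (B y x) 0)"
  define N where "N = (\<lambda>y x. max (- B y x) 0)"
  have P_props: "\<And>y x. 0 \<le> P y x" "\<And>g y x. g \<in> G \<Longrightarrow> P (g y) (g x) = P y x"
    by (simp_all add: P_def inv)
  have N_props: "\<And>y x. 0 \<le> N y x" "\<And>g y x. g \<in> G \<Longrightarrow> N (g y) (g x) = N y x"
    by (simp_all add: N_def inv)
  obtain p a where p: "\<And>h. 0 \<le> a h"
      "\<And>y x. P y x = (\<Sum>h | bij h. a h * of_bool (h x = y))"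
      "(\<Sum>h | bij h. a h) = p" "\<And>y. (\<Sum>x\<in>UNIV. P y x) = p"
    using decompose[of P, OF P_props] by blast
  obtain n b where n: "\<And>h. 0 \<le> b h"
      "\<And>y x. N y x = (\<Sum>h | bij h. b h * of_bool (h x = y))"
      "(\<Sum>h | bij h. b h) = n" "\<And>y. (\<Sum>x\<in>UNIV. N y x) = n"
    using decompose[of N, OF N_props] by blast
  show thesis
  proof (rule that[of "\<lambda>h. a h - b h"])
    fix y x
    have "B y x = P y x - N y x"
      by (simp add: P_def N_def)
    then show "B y x = (\<Sum>h | bij h. (a h - b h) * of_bool (h x = y))"
      by (simp add: p(2) n(2) left_diff_distrib sum_subtractf)
  next
    fix y
    have "(\<Sum>h | bij h. \<bar>a h - b h\<bar>) \<le> (\<Sum>h | bij h. a h + b h)"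
    proof (rule sum_mono)
      fix h show "\<bar>a h - b h\<bar> \<le> a h + b h"
        using p(1)[of h] n(1)[of h] by linarith
    qed
    also have "\<dots> = (\<Sum>x\<in>UNIV. P y x + N y x)"
      by (simp add: sum.distrib p(3,4) n(3,4))
    also have "\<dots> = (\<Sum>x\<in>UNIV. \<bar>B y x\<bar>)"
      by (intro sum.cong) (auto simp: P_def N_def)
    finally show "(\<Sum>h | bij h. \<bar>a h - b h\<bar>) \<le> (\<Sum>x\<in>UNIV. \<bar>B y x\<bar>)" .
  qed
qed

section \<open>Averaging over conjugation\<close>

abbreviation conjugate :: "('a \<Rightarrow> 'a) \<Rightarrow> ('a \<Rightarrow> 'a) \<Rightarrow> 'a \<Rightarrow> 'a" where
  "conjugate g h \<equiv> g \<circ> h \<circ> inv_into UNIV g"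

lemma bij_betw_conjugate:
  assumes "bij g"
  shows "bij_betw (conjugate g) {h. bij h} {h. bij h}"
proof (rule bij_betw_byWitness[where f' = "\<lambda>h. inv_into UNIV g \<circ> h \<circ> g"])
  show "\<forall>h\<in>{h. bij h}. inv_into UNIV g \<circ> conjugate g h \<circ> g = h"
    using assms by (simp add: fun_eq_iff bij_is_inj)
  show "\<forall>h\<in>{h. bij h}. conjugate g (inv_into UNIV g \<circ> h \<circ> g) = h"
    using assms by (simp add: fun_eq_iff bij_is_surj surj_f_inv_f)
qed (use assms in \<open>auto intro!: bij_comp bij_imp_bij_inv\<close>)

lemma inj_conjugate:
  assumes "bij g"
  shows "inj (conjugate g)"
proof (rule inj_on_inverseI)
  show "inv_into UNIV g \<circ> conjugate g h \<circ> g = h" for h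
    using assms by (simp add: fun_eq_iff bij_is_inj)
qed

lemma conjugate_comp:
  assumes "bij g" "bij k"
  shows "conjugate g (conjugate k h) = conjugate (g \<circ> k) h"
  using assms by (simp add: o_inv_distrib comp_assoc)

text \<open>
  The permutation matrix of a conjugate of \<open>h\<close> is the relabelled permutation matrix of \<open>h\<close>, so each term
  of the average represents a relabelling of \<open>B\<close>, which is \<open>B\<close> again.  Conjugating the argument of
  the average only permutes its terms, and conjugation permutes the terms of the absolute sum as well.
\<close>

lemma average_over_conjugation:
  fixes B :: "'a::finite \<Rightarrow> 'a \<Rightarrow> real"
  assumes G: "subgroup G Aut"
    and inv: "\<And>g y x. g \<in> G \<Longrightarrow> B (g y) (g x) = B y x"
    and a: "\<And>y x. B y x = (\<Sum>h | bij h. a h * of_bool (h x = y))"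
  obtains m where "\<And>y x. B y x = (\<Sum>h | bij h. m h * of_bool (h x = y))"
    and "\<And>g h. g \<in> G \<Longrightarrow> m (conjugate g h) = m h"
    and "(\<Sum>h | bij h. \<bar>m h\<bar>) \<le> (\<Sum>h | bij h. \<bar>a h\<bar>)"
proof -
  note grp = subgroup_Aut_facts[OF G]
  have cG: "0 < real (card G)"
    using grp(4) by (auto simp: card_gt_0_iff)
  define m where "m = (\<lambda>h. (\<Sum>g\<in>G. a (conjugate g h)) / card G)"
  have reindex: "(\<Sum>h | bij h. f (conjugate g h)) = (\<Sum>h | bij h. f h)"
    if "g \<in> G" for g and f :: "('a \<Rightarrow> 'a) \<Rightarrow> real"
    by (rule sum.reindex_bij_betw[OF bij_betw_conjugate[OF grp(1)[OF that]]])
  show thesis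
  proof (rule that[of m])
    fix y x
    have conjugated: "(\<Sum>h | bij h. a (conjugate g h) * of_bool (h x = y)) = B y x" if g: "g \<in> G" for g
    proof -
      have "conjugate g h (g x) = g y \<longleftrightarrow> h x = y" for h
        using grp(1)[OF g] by (simp add: bij_is_inj inj_eq)
      then have "(\<Sum>h | bij h. a (conjugate g h) * of_bool (h x = y)) =
          (\<Sum>h | bij h. a (conjugate g h) * of_bool (conjugate g h (g x) = g y))"
        by simp
      also have "\<dots> = (\<Sum>h | bij h. a h * of_bool (h (g x) = g y))"
        by (rule reindex[OF g])
      also have "\<dots> = B y x"
        using a[of "g y" "g x"] inv[OF g] by simp
      finally show ?thesis .
    qed
    have "(\<Sum>h | bij h. m h * of_bool (h x = y)) =
        (\<Sum>h | bij h. \<Sum>g\<in>G. a (conjugate g h) * of_bool (h x = y)) / card G"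
      by (simp add: m_def sum_distrib_right sum_divide_distrib del: sum_mult_of_bool_eq)
    also have "\<dots> = (\<Sum>g\<in>G. \<Sum>h | bij h. a (conjugate g h) * of_bool (h x = y)) / card G"
      by (subst sum.swap) simp
    also have "\<dots> = B y x"
      using grp(4) by (auto simp: conjugated simp del: sum_mult_of_bool_eq)
    finally show "B y x = (\<Sum>h | bij h. m h * of_bool (h x = y))" ..
  next
    fix k h assume k: "k \<in> G"
    \<comment> \<open>Conjugating the argument by \<open>k\<close> amounts to translating the summation index by \<open>k\<close> within \<open>G\<close>.\<close>
    have kG: "bij_betw (\<lambda>g. g \<circ> k) G G"
    proof (rule bij_betw_byWitness[where f' = "\<lambda>g. g \<circ> inv_into UNIV k"])
      show "\<forall>g\<in>G. g \<circ> k \<circ> inv_into UNIV k = g"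
        using grp(1)[OF k] by (simp add: fun_eq_iff bij_is_surj surj_f_inv_f)
      show "\<forall>g\<in>G. g \<circ> inv_into UNIV k \<circ> k = g"
        using grp(1)[OF k] by (simp add: fun_eq_iff bij_is_inj)
    qed (use k grp(2,3) in blast)+
    have "(\<Sum>g\<in>G. a (conjugate g (conjugate k h))) = (\<Sum>g\<in>G. a (conjugate (g \<circ> k) h))"
      by (intro sum.cong refl arg_cong[of _ _ a] conjugate_comp grp(1) k)
    also have "\<dots> = (\<Sum>g\<in>G. a (conjugate g h))"
      by (rule sum.reindex_bij_betw[OF kG])
    finally show "m (conjugate k h) = m h"
      by (simp add: m_def)
  next
    have "(\<Sum>h | bij h. \<bar>m h\<bar>) \<le> (\<Sum>h | bij h. (\<Sum>g\<in>G. \<bar>a (conjugate g h)\<bar>) / card G)"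
      using cG by (intro sum_mono) (simp add: m_def abs_divide divide_right_mono)
    also have "\<dots> = (\<Sum>g\<in>G. \<Sum>h | bij h. \<bar>a (conjugate g h)\<bar>) / card G"
      by (subst sum.swap) (simp add: sum_divide_distrib)
    also have "\<dots> = (\<Sum>h | bij h. \<bar>a h\<bar>)"
      using grp(4) by (auto simp: reindex[where f = "\<lambda>h. \<bar>a h\<bar>"])
    finally show "(\<Sum>h | bij h. \<bar>m h\<bar>) \<le> (\<Sum>h | bij h. \<bar>a h\<bar>)" .
  qed
qed

text \<open>
  Countable additivity is checked one point at a time: a point lies in at most one member of a
  disjoint family, so its contributions form a series with at most one nonzero term.
\<close>

lemma finite_signed_measure_sum:
  assumes "finite \<Omega>"
  shows "finite_signed_measure \<Omega> (Pow \<Omega>) (\<lambda>H. \<Sum>h\<in>H. m h)"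
  unfolding finite_signed_measure_def
proof (intro conjI allI impI)
  show "sigma_algebra \<Omega> (Pow \<Omega>)"
    by (rule sigma_algebra_Pow)
  fix A :: "nat \<Rightarrow> 'a set"
  assume sub: "range A \<subseteq> Pow \<Omega>" and disj: "disjoint_family A"
  have extend: "(\<Sum>h\<in>H. m h) = (\<Sum>h\<in>\<Omega>. if h \<in> H then m h else 0)" if "H \<subseteq> \<Omega>" for H
    using that assms by (simp add: sum.If_cases Int_absorb1)
  have "(\<lambda>i. \<Sum>h\<in>\<Omega>. if h \<in> A i then m h else 0) sums
      (\<Sum>h\<in>\<Omega>. if h \<in> (\<Union>i. A i) then m h else 0)"
  proof (rule sums_sum)
    fix h
    show "(\<lambda>i. if h \<in> A i then m h else 0) sums (if h \<in> (\<Union>i. A i) then m h else 0)"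
    proof (cases "\<exists>i. h \<in> A i")
      case True
      then obtain j where j: "h \<in> A j"
        by blast
      then have "h \<in> A i \<longleftrightarrow> i = j" for i
        using disj by (auto simp: disjoint_family_on_def)
      then show ?thesis
        using sums_single[of j "\<lambda>_. m h"] j by auto
    qed auto
  qed
  then show "(\<lambda>i. \<Sum>h\<in>A i. m h) sums (\<Sum>h\<in>(\<Union>i. A i). m h)"
    using sub by (simp add: extend UN_subset_iff image_subset_iff)
qed simp

section \<open>Matrices of equivariant non-expansive maps\<close>

lemma carrier_Aut: "carrier Aut = {h. bij h}"
  using mem_carrier_Aut by auto

lemma linear_nth_eq_sum:
  fixes F :: "real ^ 'a::finite \<Rightarrow> real ^ 'a"
  assumes "linear F"
  shows "F \<phi> $ y = (\<Sum>x\<in>UNIV. matrix F $ y $ x * \<phi> $ x)"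
proof -
  have "F \<phi> = matrix F *v \<phi>"
    using matrix_vector_mul assms linear_matrix_vector_mul_eq by metis
  then show ?thesis
    by (simp add: matrix_vector_mult_def)
qed

lemma infnorm_le_iff:
  fixes \<phi> :: "real ^ 'a::finite"
  shows "infnorm \<phi> \<le> c \<longleftrightarrow> (\<forall>x. \<bar>\<phi> $ x\<bar> \<le> c)"
  by (auto simp: infnorm_eq_Max)

lemma matrix_equivariant:
  fixes F :: "real ^ 'a::finite \<Rightarrow> real ^ 'a"
  assumes "GEO G F" "g \<in> G" "bij g"
  shows "matrix F $ g y $ g x = matrix F $ y $ x"
proof -
  have "comp_right (axis (g x) 1) g = (axis x 1 :: real ^ 'a)"
    using \<open>bij g\<close> by (simp add: comp_right_def vec_eq_iff axis_def bij_is_inj inj_eq)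
  then have "F (axis x 1) = comp_right (F (axis (g x) 1)) g"
    using assms(1,2) by (metis GEO_def)
  then show ?thesis
    by (simp add: matrix_def comp_right_def)
qed

text \<open>The sign pattern of row \<open>y\<close> has norm at most 1, and \<open>F\<close> maps it to a vector with the absolute row sum at \<open>y\<close>.\<close>

lemma matrix_row_sum_le_1:
  fixes F :: "real ^ 'a::finite \<Rightarrow> real ^ 'a"
  assumes "linear F" and "\<And>\<phi>. infnorm (F \<phi>) \<le> infnorm \<phi>"
  shows "(\<Sum>x\<in>UNIV. \<bar>matrix F $ y $ x\<bar>) \<le> 1"
proof -
  define \<phi> :: "real ^ 'a" where "\<phi> = (\<chi> x. sgn (matrix F $ y $ x))"
  have "(\<Sum>x\<in>UNIV. \<bar>matrix F $ y $ x\<bar>) = F \<phi> $ y"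
    by (simp add: linear_nth_eq_sum[OF assms(1)] \<phi>_def abs_sgn)
  also have "\<dots> \<le> infnorm (F \<phi>)"
    using component_le_infnorm_cart[of "F \<phi>" y] by linarith
  also have "\<dots> \<le> infnorm \<phi>"
    by (rule assms(2))
  also have "\<dots> \<le> 1"
    by (simp add: infnorm_le_iff \<phi>_def abs_sgn_eq)
  finally show ?thesis .
qed

section \<open>The representation theorem\<close>

lemma permutant_measure_of_GENEO:
  fixes F :: "real ^ 'a::finite \<Rightarrow> real ^ 'a"
  assumes G: "subgroup G Aut" "acts_transitively G" and F: "linear F" "GENEO G F"
  shows "\<exists>\<mu>. permutant_measure G \<mu> \<and>
      (\<forall>\<phi>. F \<phi> = (\<Sum>h\<in>carrier Aut. \<mu> {h} *\<^sub>R comp_right \<phi> (inv_into UNIV h))) \<and>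
      (\<Sum>h\<in>carrier Aut. \<bar>\<mu> {h}\<bar>) \<le> 1"
proof -
  note bij = subgroup_Aut_facts(1)[OF G(1)]
  define B where "B = (\<lambda>y x. matrix F $ y $ x)"
  have trans: "\<And>x y. \<exists>g\<in>G. g x = y"
    using G acts_transitively_iff by blast
  have inv: "B (g y) (g x) = B y x" if "g \<in> G" for g y x
    using F(2) unfolding B_def GENEO_def by (metis matrix_equivariant that bij)
  have nonexp: "infnorm (F \<phi>) \<le> infnorm \<phi>" for \<phi>
    using F by (metis GENEO_def diff_zero linear_0)
  obtain a where a: "\<And>y x. B y x = (\<Sum>h | bij h. a h * of_bool (h x = y))"
      "\<And>y. (\<Sum>h | bij h. \<bar>a h\<bar>) \<le> (\<Sum>x\<in>UNIV. \<bar>B y x\<bar>)"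
    using signed_birkhoff[of G B] bij trans inv by blast
  obtain m where m: "\<And>y x. B y x = (\<Sum>h | bij h. m h * of_bool (h x = y))"
      "\<And>g h. g \<in> G \<Longrightarrow> m (conjugate g h) = m h"
      "(\<Sum>h | bij h. \<bar>m h\<bar>) \<le> (\<Sum>h | bij h. \<bar>a h\<bar>)"
    using average_over_conjugation[of G B a] G(1) inv a(1) by blast
  define \<mu> where "\<mu> = (\<lambda>H. \<Sum>h\<in>H. m h)"
  have measure: "finite_signed_measure (carrier Aut) (Pow (carrier Aut)) \<mu>"
    unfolding \<mu>_def by (rule finite_signed_measure_sum) simp
  have invariant: "\<mu> H = \<mu> (conjugate g ` H)" if "g \<in> G" for H g
    using that m(2) inj_conjugate[OF bij[OF that]]
    unfolding \<mu>_def by (subst sum.reindex) (auto intro: inj_on_subset)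
  have represents: "F \<phi> = (\<Sum>h\<in>carrier Aut. \<mu> {h} *\<^sub>R comp_right \<phi> (inv_into UNIV h))" for \<phi>
  proof (rule vec_eq_iff[THEN iffD2], rule allI)
    fix y
    have "F \<phi> $ y = (\<Sum>x\<in>UNIV. \<Sum>h | bij h. m h * of_bool (h x = y) * \<phi> $ x)"
      by (simp add: linear_nth_eq_sum[OF F(1)] m(1)[unfolded B_def] sum_distrib_right del: sum_mult_of_bool_eq)
    also have "\<dots> = (\<Sum>h | bij h. \<Sum>x\<in>UNIV. m h * of_bool (h x = y) * \<phi> $ x)"
      by (rule sum.swap)
    also have "\<dots> = (\<Sum>h | bij h. m h * \<phi> $ inv_into UNIV h y)"
    proof (rule sum.cong[OF refl])
      fix h :: "'a \<Rightarrow> 'a" assume "h \<in> {h. bij h}"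
      then have "h x = y \<longleftrightarrow> x = inv_into UNIV h y" for x
        by (simp add: bij_inv_eq_iff)
      then have "(\<Sum>x\<in>UNIV. m h * of_bool (h x = y) * \<phi> $ x) =
          (\<Sum>x\<in>UNIV. if x = inv_into UNIV h y then m h * \<phi> $ x else 0)"
        by (intro sum.cong) auto
      then show "(\<Sum>x\<in>UNIV. m h * of_bool (h x = y) * \<phi> $ x) = m h * \<phi> $ inv_into UNIV h y"
        by simp
    qed
    finally show "F \<phi> $ y = (\<Sum>h\<in>carrier Aut. \<mu> {h} *\<^sub>R comp_right \<phi> (inv_into UNIV h)) $ y"
      by (simp add: \<mu>_def carrier_Aut comp_right_def)
  qed
  have variation: "(\<Sum>h\<in>carrier Aut. \<bar>\<mu> {h}\<bar>) \<le> 1"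
    using m(3) a(2)[of undefined] matrix_row_sum_le_1[OF F(1) nonexp, of undefined]
    by (simp add: \<mu>_def carrier_Aut B_def)
  show ?thesis
    unfolding permutant_measure_def
    by (intro exI[of _ \<mu>] conjI allI impI ballI measure invariant represents variation)
qed

lemma linear_permutation_sum:
  fixes c :: "('a::finite \<Rightarrow> 'a) \<Rightarrow> real"
  shows "linear (\<lambda>\<phi>. \<Sum>h\<in>A. c h *\<^sub>R comp_right \<phi> (inv_into UNIV h))"
  by (rule linearI)
    (simp_all add: vec_eq_iff comp_right_def sum.distrib distrib_left sum_distrib_left mult.left_commute)

text \<open>
  Substituting the conjugate of \<open>h\<close> by \<open>g\<close> for \<open>h\<close> in the sum leaves the weights alone and moves \<open>g\<close> from the
  right of the inverse of \<open>h\<close> to its left.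
\<close>

lemma GEO_permutation_sum:
  fixes c :: "('a::finite \<Rightarrow> 'a) \<Rightarrow> real"
  assumes bij: "\<And>g. g \<in> G \<Longrightarrow> bij g"
    and c: "\<And>g h. g \<in> G \<Longrightarrow> bij h \<Longrightarrow> c (conjugate g h) = c h"
  shows "GEO G (\<lambda>\<phi>. \<Sum>h | bij h. c h *\<^sub>R comp_right \<phi> (inv_into UNIV h))"
  unfolding GEO_def
proof (intro allI ballI)
  fix \<phi> :: "real ^ 'a" and g assume g: "g \<in> G"
  note bg = bij[OF g]
  show "(\<Sum>h | bij h. c h *\<^sub>R comp_right (comp_right \<phi> g) (inv_into UNIV h)) =
      comp_right (\<Sum>h | bij h. c h *\<^sub>R comp_right \<phi> (inv_into UNIV h)) g"
  proof (rule vec_eq_iff[THEN iffD2], rule allI)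
    fix y
    have "comp_right (\<Sum>h | bij h. c h *\<^sub>R comp_right \<phi> (inv_into UNIV h)) g $ y =
        (\<Sum>h | bij h. c h * \<phi> $ inv_into UNIV h (g y))"
      by (simp add: comp_right_def)
    also have "\<dots> = (\<Sum>h | bij h. c (conjugate g h) * \<phi> $ inv_into UNIV (conjugate g h) (g y))"
      by (rule sum.reindex_bij_betw[OF bij_betw_conjugate[OF bg], symmetric])
    also have "\<dots> = (\<Sum>h | bij h. c h * \<phi> $ g (inv_into UNIV h y))"
    proof (rule sum.cong[OF refl])
      fix h :: "'a \<Rightarrow> 'a" assume "h \<in> {h. bij h}"
      then have h: "bij h" by simp
      have "conjugate g h (g (inv_into UNIV h y)) = g y"
        using bg h by (simp add: bij_is_inj bij_is_surj surj_f_inv_f)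
      moreover have "inj (conjugate g h)"
        using bg h by (intro bij_is_inj bij_comp bij_imp_bij_inv)
      ultimately have "inv_into UNIV (conjugate g h) (g y) = g (inv_into UNIV h y)"
        by (metis inv_f_f)
      then show "c (conjugate g h) * \<phi> $ inv_into UNIV (conjugate g h) (g y) =
          c h * \<phi> $ g (inv_into UNIV h y)"
        using c[OF g h] by simp
    qed
    finally show "(\<Sum>h | bij h. c h *\<^sub>R comp_right (comp_right \<phi> g) (inv_into UNIV h)) $ y =
        comp_right (\<Sum>h | bij h. c h *\<^sub>R comp_right \<phi> (inv_into UNIV h)) g $ y"
      by (simp add: comp_right_def)
  qed
qed

lemma infnorm_permutation_sum_le:
  fixes c :: "('a::finite \<Rightarrow> 'a) \<Rightarrow> real"
  assumes "(\<Sum>h\<in>A. \<bar>c h\<bar>) \<le> 1"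
  shows "infnorm (\<Sum>h\<in>A. c h *\<^sub>R comp_right \<phi> (inv_into UNIV h)) \<le> infnorm \<phi>"
  unfolding infnorm_le_iff
proof
  fix y
  have "\<bar>(\<Sum>h\<in>A. c h *\<^sub>R comp_right \<phi> (inv_into UNIV h)) $ y\<bar> \<le>
      (\<Sum>h\<in>A. \<bar>c h * \<phi> $ inv_into UNIV h y\<bar>)"
    by (simp add: comp_right_def)
  also have "\<dots> \<le> (\<Sum>h\<in>A. \<bar>c h\<bar> * infnorm \<phi>)"
    by (intro sum_mono) (simp add: abs_mult mult_left_mono component_le_infnorm_cart)
  also have "\<dots> \<le> infnorm \<phi>"
    using assms by (simp add: sum_distrib_right[symmetric] mult_left_le_one_le infnorm_pos_le sum_nonneg)
  finally show "\<bar>(\<Sum>h\<in>A. c h *\<^sub>R comp_right \<phi> (inv_into UNIV h)) $ y\<bar> \<le> infnorm \<phi>" .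
qed

theorem theorem3:
  fixes G :: "('a::finite \<Rightarrow> 'a) set"
    and F :: "real ^ 'a \<Rightarrow> real ^ 'a"
  assumes "subgroup G Aut"
    and "acts_transitively G"
  shows "linear F \<and> GENEO G F \<longleftrightarrow>
    (\<exists>\<mu>. permutant_measure G \<mu> \<and>
      (\<forall>\<phi>. F \<phi> = (\<Sum>h\<in>carrier Aut. \<mu> {h} *\<^sub>R comp_right \<phi> (inv_into UNIV h))) \<and>
      (\<Sum>h\<in>carrier Aut. \<bar>\<mu> {h}\<bar>) \<le> 1)"
proof
  assume "linear F \<and> GENEO G F"
  then show "\<exists>\<mu>. permutant_measure G \<mu> \<and>
      (\<forall>\<phi>. F \<phi> = (\<Sum>h\<in>carrier Aut. \<mu> {h} *\<^sub>R comp_right \<phi> (inv_into UNIV h))) \<and>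
      (\<Sum>h\<in>carrier Aut. \<bar>\<mu> {h}\<bar>) \<le> 1"
    using permutant_measure_of_GENEO[OF assms] by blast
next
  assume "\<exists>\<mu>. permutant_measure G \<mu> \<and>
      (\<forall>\<phi>. F \<phi> = (\<Sum>h\<in>carrier Aut. \<mu> {h} *\<^sub>R comp_right \<phi> (inv_into UNIV h))) \<and>
      (\<Sum>h\<in>carrier Aut. \<bar>\<mu> {h}\<bar>) \<le> 1"
  then obtain \<mu> where \<mu>: "permutant_measure G \<mu>"
      "\<And>\<phi>. F \<phi> = (\<Sum>h | bij h. \<mu> {h} *\<^sub>R comp_right \<phi> (inv_into UNIV h))"
      "(\<Sum>h | bij h. \<bar>\<mu> {h}\<bar>) \<le> 1"
    unfolding carrier_Aut by blast
  have F: "F = (\<lambda>\<phi>. \<Sum>h | bij h. \<mu> {h} *\<^sub>R comp_right \<phi> (inv_into UNIV h))"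
    using \<mu>(2) by blast
  have "linear F"
    unfolding F by (rule linear_permutation_sum)
  moreover have "\<mu> {conjugate g h} = \<mu> {h}" if "g \<in> G" "bij h" for g h
  proof -
    have "\<mu> {h} = \<mu> (conjugate g ` {h})"
      using \<mu>(1) that unfolding permutant_measure_def carrier_Aut by blast
    then show ?thesis
      by simp
  qed
  then have "GEO G F"
    unfolding F using subgroup_Aut_facts(1)[OF assms(1)] by (intro GEO_permutation_sum)
  moreover have "infnorm (F \<phi>\<^sub>1 - F \<phi>\<^sub>2) \<le> infnorm (\<phi>\<^sub>1 - \<phi>\<^sub>2)" for \<phi>\<^sub>1 \<phi>\<^sub>2
    using infnorm_permutation_sum_le[OF \<mu>(3), of "\<phi>\<^sub>1 - \<phi>\<^sub>2"] \<open>linear F\<close>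
    by (metis \<mu>(2) linear_diff)
  ultimately show "linear F \<and> GENEO G F"
    by (simp add: GENEO_def)
qed

end
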